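(* Let $\mathbf{D}\in\mathbb{R}^{n\times n}$ be skew-symmetric and let $H:\mathbb{R}^n\to\mathbb{R}$ be continuously differentiable with globally Lipschitz gradient, $\mathcal{L}[\nabla_{\mathbf u}H]<\infty$. For every $T>0$ and $\mu>0$ there is a constant $C(T,\mu)$, depending only on $T$, $\mu$ and the fixed data $\mathbf{D}$, $H$, such that the following holds. Let $\mathbf{u}:[0,T]\to\mathbb{R}^n$ be the solution of the full-order model $$\dot{\mathbf u}=\mathbf{D}\,\nabla_{\mathbf u}H(\mathbf u),\qquad \mathbf u(0)=\mathbf u_0 .$$ Let $d$ be the rank of the shifted snapshot covariance matrix $$\mathbf R=\int_0^T (\mathbf u(t)-\mathbf u_0)(\mathbf u(t)-\mathbf u_0)^\top\,dt+\mu^2\int_0^T \nabla_{\mathbf u}H(\mathbf u(t))\,\nabla_{\mathbf u}H(\mathbf u(t))^\top\,dt,$$ let $\lambda_1\ge\lambda_2\ge\dots\ge\lambda_d>0$ be its nonzero eigenvalues (counted with multiplicity), let $1\le r\le d$, and let $\boldsymbol{\Phi}\in\mathbb{R}^{n\times r}$ be the $r$-dimensional POD basis matrix associated with $\mathbf R$. Let $\mathbf a:[0,T]\to\mathbb{R}^r$ be the solution of the structure-preserving reduced-order model $$\dot{\mathbf a}=\mathbf D_r\,\nabla_{\mathbf a}H(\mathbf u_0+\boldsymbol\Phi\mathbf a),\qquad \mathbf D_r=\boldsymbol\Phi^\top\mathbf D\boldsymbol\Phi,\qquad \mathbf a(0)=\mathbf 0 .$$ Then $$\int_0^T\|\mathbf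 u(t)-(\mathbf u_0+\boldsymbol\Phi\mathbf a(t))\|^2\,dt\le C(T,\mu)\sum_{j=r+1}^{d}\lambda_j .$$
   Context: $\|\cdot\|$ is the Euclidean norm. For $F:\mathbb{R}^n\to\mathbb{R}^n$ the Lipschitz constant is $\mathcal L[F]=\sup_{\mathbf u\ne\mathbf v}\|F(\mathbf u)-F(\mathbf v)\|/\|\mathbf u-\mathbf v\|$. The gradient with respect to reduced coordinates is $\nabla_{\mathbf a}H(\mathbf u_0+\boldsymbol\Phi\mathbf a)=\boldsymbol\Phi^\top\nabla_{\mathbf u}H(\mathbf u_0+\boldsymbol\Phi\mathbf a)$, i.e. the gradient of $\mathbf a\mapsto H(\mathbf u_0+\boldsymbol\Phi\mathbf a)$. The shifted snapshots consist of $\mathbf u(t)-\mathbf u_0$ and the weighted gradient $\mu\nabla_{\mathbf u}H(\mathbf u(t))$, where the entire continuous trajectory on $[0,T]$ is assumed available. The $r$-dimensional POD basis matrix $\boldsymbol\Phi=[\boldsymbol\phi_1,\dots,\boldsymbol\phi_r]$ associated with $\mathbf R$ has as columns orthonormal eigenvectors of the symmetric positive semidefinite matrix $\mathbf R$ for the $r$ largest eigenvalues $\lambda_1,\dots,\lambda_r$; thus $\boldsymbol\Phi^\top\boldsymbol\Phi=I_r$. An empty sum is $0$. Spatial and temporal discretization errors are not considered. *)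

theory Defs
  imports "HOL-Analysis.Analysis"
begin

definition gradient :: "('a::real_inner \<Rightarrow> real) \<Rightarrow> 'a \<Rightarrow> 'a" where
  "gradient f x = (THE g. GDERIV f x :> g)"

definition continuously_differentiable :: "('a::real_inner \<Rightarrow> real) \<Rightarrow> bool" where
  "continuously_differentiable f \<longleftrightarrow>
     (\<forall>x. f differentiable (at x)) \<and> continuous_on UNIV (gradient f)"

definition lipschitz_constant :: "('a::real_normed_vector \<Rightarrow> 'b::real_normed_vector) \<Rightarrow> ennreal" where
  "lipschitz_constant F =
     (SUP (u, v) \<in> {(u, v). u \<noteq> v}. ennreal (norm (F u - F v) / norm (u - v)))"

definition skew_symmetric :: "real^'n^'n \<Rightarrow> bool" where
  "skew_symmetric A \<longleftrightarrow> transpose A = - A"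

definition outer :: "real^'n \<Rightarrow> real^'n \<Rightarrow> real^'n^'n" where
  "outer x y = (\<chi> i j. x $ i * y $ j)"

lemma outer_eq_matrix_product:
  "outer x y = (columnvector x :: real^1^'n) ** (rowvector y :: real^'n^1)"
  by (simp add: outer_def columnvector_def rowvector_def matrix_matrix_mult_def)

definition snapshot_covariance ::
    "real \<Rightarrow> real \<Rightarrow> (real^'n \<Rightarrow> real) \<Rightarrow> real^'n \<Rightarrow> (real \<Rightarrow> real^'n) \<Rightarrow> real^'n^'n" where
  "snapshot_covariance T \<mu> H u0 u =
     integral {0..T} (\<lambda>t. outer (u t - u0) (u t - u0))
     + \<mu>\<^sup>2 *\<^sub>R integral {0..T} (\<lambda>t. outer (gradient H (u t)) (gradient H (u t)))"

definition eigenspace :: "real^'n^'n \<Rightarrow> real \<Rightarrow> (real^'n) set" where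
  "eigenspace A c = {v. A *v v = c *\<^sub>R v}"

(* lam 1 >= ... >= lam d > 0 are the nonzero eigenvalues of A, each occurring as often as its
   multiplicity. Only used for symmetric A, so the multiplicity is the dimension of the eigenspace. *)
definition nonzero_eigenvalues :: "real^'n^'n \<Rightarrow> nat \<Rightarrow> (nat \<Rightarrow> real) \<Rightarrow> bool" where
  "nonzero_eigenvalues A d lam \<longleftrightarrow>
     (\<forall>i\<in>{1..d}. \<forall>j\<in>{1..d}. i \<le> j \<longrightarrow> lam j \<le> lam i) \<and>
     (\<forall>j\<in>{1..d}. 0 < lam j) \<and>
     (\<forall>c. c \<noteq> 0 \<longrightarrow> card {j\<in>{1..d}. lam j = c} = dim (eigenspace A c))"

(* The reduced dimension r is a number, not a type, so that it can be quantified after the constant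
   in the error bound. An n x r matrix is therefore given by its columns phi 1, ..., phi r, and a
   vector of reduced coordinates by its entries a 1, ..., a r; other indices are never used. *)

definition pod_basis :: "real^'n^'n \<Rightarrow> (nat \<Rightarrow> real) \<Rightarrow> nat \<Rightarrow> (nat \<Rightarrow> real^'n) \<Rightarrow> bool" where
  "pod_basis R lam r phi \<longleftrightarrow>
     (\<forall>i\<in>{1..r}. \<forall>j\<in>{1..r}. phi i \<bullet> phi j = (if i = j then 1 else 0)) \<and>
     (\<forall>j\<in>{1..r}. R *v phi j = lam j *\<^sub>R phi j)"

(* Phi a *)
definition lift :: "nat \<Rightarrow> (nat \<Rightarrow> real^'n) \<Rightarrow> (nat \<Rightarrow> real) \<Rightarrow> real^'n" where
  "lift r phi a = (\<Sum>j=1..r. a j *\<^sub>R phi j)"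

(* the (i,j) entry of Phi^T D Phi *)
definition reduced_matrix :: "real^'n^'n \<Rightarrow> (nat \<Rightarrow> real^'n) \<Rightarrow> nat \<Rightarrow> nat \<Rightarrow> real" where
  "reduced_matrix D phi i j = phi i \<bullet> (D *v phi j)"

(* the j-th entry of Phi^T (grad H) (u0 + Phi a) *)
definition reduced_gradient ::
    "(real^'n \<Rightarrow> real) \<Rightarrow> real^'n \<Rightarrow> nat \<Rightarrow> (nat \<Rightarrow> real^'n) \<Rightarrow> (nat \<Rightarrow> real) \<Rightarrow> nat \<Rightarrow> real" where
  "reduced_gradient H u0 r phi a j = phi j \<bullet> gradient H (u0 + lift r phi a)"

definition fom_solution ::
    "real \<Rightarrow> real^'n^'n \<Rightarrow> (real^'n \<Rightarrow> real) \<Rightarrow> real^'n \<Rightarrow> (real \<Rightarrow> real^'n) \<Rightarrow> bool" where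
  "fom_solution T D H u0 u \<longleftrightarrow>
     u 0 = u0 \<and>
     (\<forall>t\<in>{0..T}. (u has_vector_derivative D *v gradient H (u t)) (at t within {0..T}))"

definition rom_solution ::
    "real \<Rightarrow> real^'n^'n \<Rightarrow> (real^'n \<Rightarrow> real) \<Rightarrow> real^'n \<Rightarrow> nat \<Rightarrow> (nat \<Rightarrow> real^'n)
      \<Rightarrow> (real \<Rightarrow> nat \<Rightarrow> real) \<Rightarrow> bool" where
  "rom_solution T D H u0 r phi a \<longleftrightarrow>
     (\<forall>i\<in>{1..r}. a 0 i = 0) \<and>
     (\<forall>t\<in>{0..T}. \<forall>i\<in>{1..r}.
        ((\<lambda>s. a s i) has_real_derivative
           (\<Sum>j=1..r. reduced_matrix D phi i j * reduced_gradient H u0 r phi (a t) j))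
        (at t within {0..T}))"

lemma GDERIV_gradient:
  fixes f :: "'a::euclidean_space \<Rightarrow> real"
  assumes "f differentiable (at x)"
  shows "GDERIV f x :> gradient f x"
proof -
  from assms obtain f' where f': "(f has_derivative f') (at x)"
    by (auto simp: differentiable_def)
  interpret bounded_linear f' by (rule has_derivative_bounded_linear[OF f'])
  have "f' h = h \<bullet> (\<Sum>b\<in>Basis. f' b *\<^sub>R b)" for h
  proof -
    have "f' h = f' (\<Sum>b\<in>Basis. (h \<bullet> b) *\<^sub>R b)" by (simp add: euclidean_representation)
    also have "\<dots> = (\<Sum>b\<in>Basis. (h \<bullet> b) * f' b)" by (simp add: sum scaleR)
    also have "\<dots> = h \<bullet> (\<Sum>b\<in>Basis. f' b *\<^sub>R b)"
      by (simp add: inner_sum_right mult.commute)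
    finally show ?thesis .
  qed
  hence "f' = (\<lambda>h. h \<bullet> (\<Sum>b\<in>Basis. f' b *\<^sub>R b))" by blast
  with f' have ex: "GDERIV f x :> (\<Sum>b\<in>Basis. f' b *\<^sub>R b)"
    by (simp add: gderiv_def)
  have uniq: "g = g'" if "GDERIV f x :> g" "GDERIV f x :> g'" for g g'
  proof -
    have "(\<lambda>h. h \<bullet> g) = (\<lambda>h. h \<bullet> g')"
      using that unfolding gderiv_def by (rule has_derivative_unique)
    hence "(g - g') \<bullet> (g - g') = 0" by (metis inner_diff_right right_minus_eq)
    thus ?thesis by simp
  qed
  show ?thesis unfolding gradient_def by (rule theI[of _ "\<Sum>b\<in>Basis. f' b *\<^sub>R b"]) (use ex uniq in auto)
qed

lemma reduced_gradient_partial_derivative: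
  assumes "H differentiable (at (u0 + lift r phi a))" "j \<in> {1..r}"
  shows "((\<lambda>s. H (u0 + lift r phi (a(j := s)))) has_real_derivative
            reduced_gradient H u0 r phi a j) (at (a j))"
proof -
  have lift: "lift r phi (a(j := s)) = lift r phi a + (s - a j) *\<^sub>R phi j" for s
  proof -
    have "lift r phi (a(j := s)) =
        (\<Sum>i=1..r. a i *\<^sub>R phi i + (if i = j then (s - a j) *\<^sub>R phi j else 0))"
      unfolding lift_def by (rule sum.cong) (auto simp: algebra_simps)
    thus ?thesis using assms(2) by (simp add: sum.distrib lift_def)
  qed
  have "((\<lambda>s. u0 + lift r phi (a(j := s))) has_derivative (\<lambda>h. h *\<^sub>R phi j)) (at (a j))"
    unfolding lift by (auto intro!: derivative_eq_intros)
  moreover have "(H has_derivative (\<lambda>h. h \<bullet> gradient H (u0 + lift r phi a)))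
      (at (u0 + lift r phi (a(j := a j))))"
    using GDERIV_gradient[OF assms(1)] by (simp add: gderiv_def)
  ultimately have "((\<lambda>s. H (u0 + lift r phi (a(j := s)))) has_derivative
      (\<lambda>h. (h *\<^sub>R phi j) \<bullet> gradient H (u0 + lift r phi a))) (at (a j))"
    by (rule has_derivative_compose)
  moreover have "(\<lambda>h. (h *\<^sub>R phi j) \<bullet> gradient H (u0 + lift r phi a))
      = (*) (reduced_gradient H u0 r phi a j)"
    by (simp add: reduced_gradient_def fun_eq_iff)
  ultimately show ?thesis
    by (simp only: has_field_derivative_def)
qed

end

(* Let P be the orthogonal projection onto the span of the POD basis. The part of the snapshots
   missed by P, integrated over time, is the trace of R minus its first r eigenvalues, i.e. the tail
   sum; the trace is expressed through an orthonormal eigenbasis of R. The remaining error theta =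
   P (u - u0) - Phi a satisfies a differential inequality driven by the two projection errors
   (I - P) (u - u0) and (I - P) grad H(u), because D grad H(u) - D P grad H(v), with v = u0 + Phi a,
   differs from D P (grad H(u) - grad H(v)) only by D (I - P) grad H(u). Gronwall's inequality
   then bounds theta by the tail sum as well; the weight mu in R controls the gradient snapshots. *)
theory Submission
  imports Defs
begin

section \<open>Eigenbases of self-adjoint maps\<close>

text \<open>The first-order condition at a minimum: near \<open>t = 0\<close> the linear term
  dominates, so a nonzero \<open>b\<close> would make one sign of \<open>t\<close> give a negative
  value.\<close>

lemma nonneg_quadratic_imp_linear_zero:
  fixes b c :: real
  assumes "\<And>t. 0 \<le> 2 * t * b + t\<^sup>2 * c"
  shows "b = 0"
proof (rule ccontr)
  assume "b \<noteq> 0"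
  \<comment> \<open>The witness \<open>t = - b / m\<close> turns the quadratic into
    \<open>b\<^sup>2 / m\<close> times \<open>c / m - 2\<close>; any positive \<open>m\<close> above
    \<open>c\<close> makes the second factor negative.\<close>
  define m where "m = \<bar>c\<bar> + 1"
  have m: "m > 0" "c < m" by (auto simp: m_def)
  have "2 * (- b / m) * b + (- b / m)\<^sup>2 * c = (b\<^sup>2 / m) * (c / m - 2)"
    using m by (simp add: field_simps power2_eq_square)
  moreover have "c / m - 2 < 0" "b\<^sup>2 / m > 0" using m \<open>b \<noteq> 0\<close> by (auto simp: field_simps)
  ultimately show False using assms[of "- b / m"] by (smt (verit) mult_pos_neg)
qed

text \<open>A maximiser of the Rayleigh quotient on the unit sphere of \<open>S\<close> is an
  eigenvector. It exists by compactness, and invariance of \<open>S\<close> keeps the residual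
  \<open>w\<close> in \<open>S\<close>, so \<open>w\<close> is an admissible direction of
  variation.\<close>

lemma selfadjoint_eigenvector_exists:
  fixes f :: "'a::euclidean_space \<Rightarrow> 'a"
  assumes f: "linear f" and sym: "\<And>x y. f x \<bullet> y = x \<bullet> f y"
    and S: "subspace S" "f ` S \<subseteq> S" "S \<noteq> {0}"
  obtains v c where "v \<in> S" "v \<noteq> 0" "f v = c *\<^sub>R v"
proof -
  interpret linear f by (rule f)
  let ?K = "S \<inter> sphere 0 1"
  have "compact ?K"
    by (intro closed_Int_compact closed_subspace S(1) compact_sphere)
  moreover have "?K \<noteq> {}"
  proof -
    obtain x where "x \<in> S" "x \<noteq> 0" using S(1,3) subspace_0 by blast
    hence "x /\<^sub>R norm x \<in> ?K" using S(1) by (simp add: subspace_scale)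
    thus ?thesis by blast
  qed
  moreover have "continuous_on ?K (\<lambda>x. x \<bullet> f x)"
    by (intro continuous_intros linear_continuous_on linear_linear[THEN iffD2] f
        linear_conv_bounded_linear[THEN iffD1])
  ultimately obtain v where v: "v \<in> ?K" and vmax: "\<And>x. x \<in> ?K \<Longrightarrow> x \<bullet> f x \<le> v \<bullet> f v"
    by (metis continuous_attains_sup)
  define M where "M = v \<bullet> f v"
  have vS: "v \<in> S" and vv: "v \<bullet> v = 1" using v by (auto simp: dot_square_norm)
  have rayleigh: "x \<bullet> f x \<le> M * (x \<bullet> x)" if x: "x \<in> S" for x
  proof (cases "x = 0")
    case False
    have "x /\<^sub>R norm x \<in> ?K" using S(1) x False by (simp add: subspace_scale)
    from vmax[OF this] False show ?thesis
      by (simp add: scaleR M_def[symmetric] dot_square_norm field_simps power2_eq_square)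
  qed (simp add: zero)
  define w where "w = M *\<^sub>R v - f v"
  have wS: "w \<in> S" unfolding w_def using S vS by (intro subspace_diff subspace_scale) auto
  \<comment> \<open>Maximality at \<open>v\<close> applied to \<open>v + t *\<^sub>R w\<close>. The
    constant term vanishes because \<open>v\<close> has norm 1, and the linear coefficient is the
    squared norm of the residual, which must therefore be 0.\<close>
  have "0 \<le> 2 * t * (w \<bullet> w) + t\<^sup>2 * (M * (w \<bullet> w) - w \<bullet> f w)" for t
  proof -
    have "v + t *\<^sub>R w \<in> S" using S(1) vS wS by (intro subspace_add subspace_scale)
    from rayleigh[OF this]
    have "0 \<le> M * ((v + t *\<^sub>R w) \<bullet> (v + t *\<^sub>R w)) - (v + t *\<^sub>R w) \<bullet> f (v + t *\<^sub>R w)" by simp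
    also have "\<dots> = 2 * t * (M * (v \<bullet> w) - f v \<bullet> w) + t\<^sup>2 * (M * (w \<bullet> w) - w \<bullet> f w)"
      using sym[of v w, symmetric]
      by (simp add: add scaleR inner_simps vv M_def[symmetric] algebra_simps inner_commute
          power2_eq_square)
    also have "M * (v \<bullet> w) - f v \<bullet> w = w \<bullet> w"
      by (simp add: w_def inner_diff_left[of "M *\<^sub>R v" "f v"])
    finally show ?thesis .
  qed
  hence "w \<bullet> w = 0" by (rule nonneg_quadratic_imp_linear_zero)
  hence "f v = M *\<^sub>R v" by (simp add: w_def)
  moreover have "v \<noteq> 0" using vv by auto
  ultimately show thesis using that vS by blast
qed

lemma selfadjoint_eigenvectors_orthogonal:
  assumes "\<And>x y. f x \<bullet> y = x \<bullet> f y" "f x = c *\<^sub>R x" "f y = c' *\<^sub>R y" "c \<noteq> c'"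
  shows "orthogonal x y"
  using assms(1)[of x y] assms(2-4) by (simp add: orthogonal_def)

text \<open>The orthogonal complement of all eigenvectors is invariant under \<open>f\<close> by
  self-adjointness. If it were nonzero it would contain an eigenvector, which would be orthogonal to
  itself.\<close>

lemma selfadjoint_span_eigenvectors:
  fixes f :: "'a::euclidean_space \<Rightarrow> 'a"
  assumes f: "linear f" and sym: "\<And>x y. f x \<bullet> y = x \<bullet> f y"
  shows "span {v. \<exists>c. f v = c *\<^sub>R v} = UNIV"
proof -
  let ?E = "{v. \<exists>c. f v = c *\<^sub>R v}"
  let ?W = "(span ?E)\<^sup>\<bottom>"
  have "?W = {0}"
  proof (rule ccontr)
    assume W: "?W \<noteq> {0}"
    have inv: "f ` ?W \<subseteq> ?W"
    proof clarify
      fix x assume x: "x \<in> ?W"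
      have "orthogonal (f x) y" if "y \<in> span ?E" for y
        using that
      proof (rule orthogonal_to_span)
        fix y assume "y \<in> ?E"
        then obtain c where c: "f y = c *\<^sub>R y" by blast
        have "y \<bullet> x = 0"
          using x span_base[OF \<open>y \<in> ?E\<close>] unfolding orthogonal_comp_def orthogonal_def by blast
        thus "orthogonal (f x) y" by (simp add: orthogonal_def sym c inner_commute[of x])
      qed
      thus "f x \<in> ?W" unfolding orthogonal_comp_def by (simp add: orthogonal_commute)
    qed
    obtain v c where v: "v \<in> ?W" "v \<noteq> 0" "f v = c *\<^sub>R v"
      using selfadjoint_eigenvector_exists[OF f sym subspace_orthogonal_comp inv W] by metis
    hence "v \<in> span ?E" by (blast intro: span_base)
    with v(1) have "v \<bullet> v = 0" unfolding orthogonal_comp_def orthogonal_def by blast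
    with v(2) show False by simp
  qed
  hence "?W\<^sup>\<bottom> = UNIV" by simp
  thus ?thesis by (simp only: orthogonal_comp_self[OF subspace_span])
qed

text \<open>The basis is the union of orthonormal bases of all eigenspaces. For a unit eigenvector
  \<open>b\<close> the number \<open>b \<bullet> f b\<close> is its eigenvalue, so the last clause
  counts multiplicities in the form used by \<open>nonzero_eigenvalues\<close>.\<close>

lemma selfadjoint_orthonormal_eigenbasis:
  fixes f :: "'a::euclidean_space \<Rightarrow> 'a"
  assumes f: "linear f" and sym: "\<And>x y. f x \<bullet> y = x \<bullet> f y"
  obtains B where "finite B" "pairwise orthogonal B" "\<And>b. b \<in> B \<Longrightarrow> norm b = 1" "span B = UNIV"
    "\<And>c. card {b \<in> B. b \<bullet> f b = c} = dim {v. f v = c *\<^sub>R v}"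
proof -
  interpret linear f by (rule f)
  have "\<forall>c. \<exists>B. B \<subseteq> {v. f v = c *\<^sub>R v} \<and> pairwise orthogonal B \<and> (\<forall>x\<in>B. norm x = 1) \<and>
      card B = dim {v. f v = c *\<^sub>R v} \<and> span B = {v. f v = c *\<^sub>R v}"
  proof
    fix c
    have "subspace {v. f v = c *\<^sub>R v}"
      by (auto simp: subspace_def add scaleR algebra_simps)
    from orthonormal_basis_subspace[OF this]
    show "\<exists>B. B \<subseteq> {v. f v = c *\<^sub>R v} \<and> pairwise orthogonal B \<and> (\<forall>x\<in>B. norm x = 1) \<and>
        card B = dim {v. f v = c *\<^sub>R v} \<and> span B = {v. f v = c *\<^sub>R v}"
      by (metis (no_types, lifting))
  qed
  then obtain B where B: "\<And>c. B c \<subseteq> {v. f v = c *\<^sub>R v}" "\<And>c. pairwise orthogonal (B c)"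
    "\<And>c x. x \<in> B c \<Longrightarrow> norm x = 1" "\<And>c. card (B c) = dim {v. f v = c *\<^sub>R v}"
    "\<And>c. span (B c) = {v. f v = c *\<^sub>R v}"
    unfolding choice_iff by blast
  define U where "U = (\<Union>c. B c)"
  have ev: "b \<bullet> f b = c" if "b \<in> B c" for b c
  proof -
    have "b \<bullet> b = 1" using B(3)[OF that] by (simp add: norm_eq_1)
    thus ?thesis using B(1)[of c] that by auto
  qed
  have orth: "pairwise orthogonal U"
  proof (rule pairwiseI)
    fix x y assume "x \<in> U" "y \<in> U" "x \<noteq> y"
    then obtain c c' where xy: "x \<in> B c" "y \<in> B c'" by (auto simp: U_def)
    show "orthogonal x y"
    proof (cases "c = c'")
      case True
      thus ?thesis using B(2)[of c] xy \<open>x \<noteq> y\<close> by (auto simp: pairwise_def)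
    next
      case False
      thus ?thesis using selfadjoint_eigenvectors_orthogonal[OF sym] B(1) xy by blast
    qed
  qed
  have norm1: "norm b = 1" if "b \<in> U" for b using that B(3) by (auto simp: U_def)
  \<comment> \<open>The union runs over all real \<open>c\<close>, so finiteness is not immediate;
    it follows from independence of nonzero orthogonal vectors.\<close>
  hence "0 \<notin> U" by fastforce
  hence fin: "finite U"
    using orth pairwise_orthogonal_independent independent_imp_finite by blast
  have "{v. \<exists>c. f v = c *\<^sub>R v} \<subseteq> span U"
  proof clarify
    fix v c assume "f v = c *\<^sub>R v"
    hence "v \<in> span (B c)" using B(5) by blast
    thus "v \<in> span U" using span_mono[of "B c" U] by (auto simp: U_def)
  qed
  hence "span U = UNIV"
    using selfadjoint_span_eigenvectors[OF f sym] span_minimal[OF _ subspace_span] by blast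
  moreover have "{b \<in> U. b \<bullet> f b = c} = B c" for c
    unfolding U_def using ev by blast
  ultimately show thesis using that[of U] fin orth norm1 B(4) by metis
qed

section \<open>Sums over orthonormal bases and over eigenvalues with multiplicity\<close>

lemma parseval:
  fixes B :: "'a::euclidean_space set"
  assumes "finite B" "pairwise orthogonal B" "\<And>b. b \<in> B \<Longrightarrow> norm b = 1" "span B = UNIV"
  shows "(norm x)\<^sup>2 = (\<Sum>b\<in>B. (b \<bullet> x)\<^sup>2)"
proof -
  have "(norm x)\<^sup>2 = x \<bullet> x" by (simp add: dot_square_norm)
  also have "\<dots> = x \<bullet> (\<Sum>b\<in>B. (x \<bullet> b) *\<^sub>R b)"
    using orthonormal_basis_expand[OF assms(2,3) _ assms(1), of x] assms(4) by simp
  also have "\<dots> = (\<Sum>b\<in>B. (b \<bullet> x)\<^sup>2)"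
    by (simp add: inner_sum_right power2_eq_square inner_commute)
  finally show ?thesis .
qed

text \<open>A finite sum depends only on how often each nonzero value occurs. This compares
  \<open>lam\<close> with the eigenvalues of a full eigenbasis without enumerating that basis; the
  kernel contributes only zeros.\<close>

lemma sum_eq_if_card_fibres_eq:
  fixes f :: "'a \<Rightarrow> 'c::ring_1" and g :: "'b \<Rightarrow> 'c"
  assumes fin: "finite A" "finite B"
    and card: "\<And>c. c \<noteq> 0 \<Longrightarrow> card {x \<in> A. f x = c} = card {y \<in> B. g y = c}"
  shows "sum f A = sum g B"
proof -
  let ?C = "f ` A \<union> g ` B"
  have "sum f A = (\<Sum>c\<in>?C. \<Sum>x\<in>{x \<in> A. f x = c}. f x)"
    using fin by (intro sum.group[symmetric]) auto
  also have "\<dots> = (\<Sum>c\<in>?C. of_nat (card {x \<in> A. f x = c}) * c)"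
    by (intro sum.cong) auto
  also have "\<dots> = (\<Sum>c\<in>?C. of_nat (card {y \<in> B. g y = c}) * c)"
    using card by (intro sum.cong refl) (metis mult_zero_right)
  also have "\<dots> = (\<Sum>c\<in>?C. \<Sum>y\<in>{y \<in> B. g y = c}. g y)"
    by (intro sum.cong) auto
  also have "\<dots> = sum g B"
    using fin by (intro sum.group) auto
  finally show ?thesis .
qed

section \<open>The projection error of the snapshots\<close>

lemma outer_mult_vector: "outer x y *v z = (y \<bullet> z) *\<^sub>R x"
  by (simp add: vec_eq_iff outer_def matrix_vector_mult_def inner_vec_def sum_distrib_left
      mult_ac)

text \<open>For fixed \<open>v\<close> and \<open>w\<close> the matrix entry is a bounded linear
  functional of the matrix, so it commutes with the integral.\<close>

lemma inner_integral_outer: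
  fixes x y :: "real \<Rightarrow> real^'n"
  assumes "continuous_on {a..b} x" "continuous_on {a..b} y"
  shows "v \<bullet> (integral {a..b} (\<lambda>t. outer (x t) (y t)) *v w) =
    integral {a..b} (\<lambda>t. (v \<bullet> x t) * (w \<bullet> y t))"
proof -
  have "bounded_linear (\<lambda>A::real^'n^'n. v \<bullet> (A *v w))"
    by (intro linear_conv_bounded_linear[THEN iffD1] linearI)
      (simp_all add: matrix_vector_mult_add_rdistrib inner_simps scaleR_matrix_vector_assoc[symmetric])
  moreover have "(\<lambda>t. outer (x t) (y t)) integrable_on {a..b}"
    unfolding outer_def
    by (intro integrable_continuous_real continuous_on_vec_lambda continuous_on_mult
        continuous_on_component assms)
  ultimately have "v \<bullet> (integral {a..b} (\<lambda>t. outer (x t) (y t)) *v w) =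
      integral {a..b} (\<lambda>t. v \<bullet> (outer (x t) (y t) *v w))"
    using integral_linear[of "\<lambda>t. outer (x t) (y t)" "{a..b}" "\<lambda>A. v \<bullet> (A *v w)"] by (simp add: o_def)
  thus ?thesis by (simp add: outer_mult_vector inner_commute[of w] mult.commute)
qed

lemma inner_snapshot_covariance:
  fixes u :: "real \<Rightarrow> real^'n"
  assumes "continuous_on {0..T} u" "continuous_on {0..T} (\<lambda>t. gradient H (u t))"
  shows "v \<bullet> (snapshot_covariance T \<mu> H u0 u *v w) =
    integral {0..T} (\<lambda>t. (v \<bullet> (u t - u0)) * (w \<bullet> (u t - u0))) +
    \<mu>\<^sup>2 * integral {0..T} (\<lambda>t. (v \<bullet> gradient H (u t)) * (w \<bullet> gradient H (u t)))"
proof -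
  have "continuous_on {0..T} (\<lambda>t. u t - u0)" by (intro continuous_intros assms)
  thus ?thesis
    using assms(2)
    by (simp add: snapshot_covariance_def matrix_vector_mult_add_rdistrib inner_add_right
        scaleR_matrix_vector_assoc[symmetric] inner_integral_outer)
qed

section \<open>Orthogonal projection onto the span of the POD basis\<close>

lemma inner_lift:
  assumes "\<forall>i\<in>{1..r}. \<forall>j\<in>{1..r}. phi i \<bullet> phi j = (if i = j then 1 else 0)"
    and "i \<in> {1..r}"
  shows "phi i \<bullet> lift r phi c = c i"
proof -
  have "phi i \<bullet> lift r phi c = (\<Sum>j=1..r. c j * (phi i \<bullet> phi j))"
    by (simp add: lift_def inner_sum_right)
  also have "\<dots> = (\<Sum>j=1..r. if i = j then c j else 0)"
    using assms by (intro sum.cong) auto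
  finally show ?thesis using assms(2) by simp
qed

lemma norm_lift:
  assumes on: "\<forall>i\<in>{1..r}. \<forall>j\<in>{1..r}. phi i \<bullet> phi j = (if i = j then 1 else 0)"
  shows "(norm (lift r phi c))\<^sup>2 = (\<Sum>j=1..r. (c j)\<^sup>2)"
proof -
  have "(norm (lift r phi c))\<^sup>2 = (\<Sum>j=1..r. c j * (phi j \<bullet> lift r phi c))"
    unfolding power2_norm_eq_inner by (subst (1) lift_def) (simp add: inner_sum_left)
  also have "\<dots> = (\<Sum>j=1..r. (c j)\<^sup>2)"
    by (intro sum.cong refl) (simp only: inner_lift[OF on] power2_eq_square)
  finally show ?thesis .
qed

text \<open>Pythagoras: \<open>?P\<close> is the orthogonal projection of \<open>x\<close>, so both
  \<open>x \<bullet> ?P\<close> and the squared norm of \<open>?P\<close> equal the sum of squared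
  coefficients.\<close>

lemma norm_diff_lift_inner:
  assumes on: "\<forall>i\<in>{1..r}. \<forall>j\<in>{1..r}. phi i \<bullet> phi j = (if i = j then 1 else 0)"
  shows "(norm (x - lift r phi (\<lambda>j. phi j \<bullet> x)))\<^sup>2 = (norm x)\<^sup>2 - (\<Sum>j=1..r. (phi j \<bullet> x)\<^sup>2)"
proof -
  let ?P = "lift r phi (\<lambda>j. phi j \<bullet> x)"
  have "x \<bullet> ?P = (\<Sum>j=1..r. (phi j \<bullet> x)\<^sup>2)"
    by (simp add: lift_def inner_sum_right power2_eq_square inner_commute)
  with norm_lift[OF on, where c = "\<lambda>j. phi j \<bullet> x"] show ?thesis
    by (simp add: power2_norm_eq_inner inner_diff_left inner_diff_right inner_commute[of ?P x])
qed

lemma norm_lift_inner_le: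
  assumes on: "\<forall>i\<in>{1..r}. \<forall>j\<in>{1..r}. phi i \<bullet> phi j = (if i = j then 1 else 0)"
  shows "norm (lift r phi (\<lambda>j. phi j \<bullet> x)) \<le> norm x"
proof (rule power2_le_imp_le)
  have "0 \<le> (norm x)\<^sup>2 - (\<Sum>j=1..r. (phi j \<bullet> x)\<^sup>2)"
    unfolding norm_diff_lift_inner[OF on, symmetric] by simp
  thus "(norm (lift r phi (\<lambda>j. phi j \<bullet> x)))\<^sup>2 \<le> (norm x)\<^sup>2"
    by (simp add: norm_lift[OF on])
qed simp

lemma continuous_on_lift:
  assumes "\<And>j. j \<in> {1..r} \<Longrightarrow> continuous_on S (\<lambda>t. a t j)"
  shows "continuous_on S (\<lambda>t. lift r phi (a t))"
  unfolding lift_def by (intro continuous_intros assms)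

text \<open>Summing the quadratic form of \<open>R\<close> over an orthonormal family gives the
  snapshot energy in its span. An eigenbasis yields the total energy and all of \<open>lam\<close>,
  the POD basis the first \<open>r\<close> eigenvalues; the difference is the energy of
  \<open>Q\<close>.\<close>

lemma pod_projection_error:
  fixes u :: "real \<Rightarrow> real^'n"
  assumes cont: "continuous_on {0..T} u" "continuous_on {0..T} (\<lambda>t. gradient H (u t))"
    and R: "R = snapshot_covariance T \<mu> H u0 u"
    and lam: "nonzero_eigenvalues R d lam" and pod: "pod_basis R lam r phi" and "r \<le> d"
  defines "Q \<equiv> \<lambda>x. x - lift r phi (\<lambda>j. phi j \<bullet> x)"
  shows "integral {0..T} (\<lambda>t. (norm (Q (u t - u0)))\<^sup>2) +
    \<mu>\<^sup>2 * integral {0..T} (\<lambda>t. (norm (Q (gradient H (u t))))\<^sup>2) = (\<Sum>j=r+1..d. lam j)"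
proof -
  let ?x = "\<lambda>t. u t - u0" and ?g = "\<lambda>t. gradient H (u t)"
  have on: "\<forall>i\<in>{1..r}. \<forall>j\<in>{1..r}. phi i \<bullet> phi j = (if i = j then 1 else 0)"
    using pod unfolding pod_basis_def by blast
  note form = inner_snapshot_covariance[OF cont, of _ \<mu> u0, folded R]
  have sym: "(R *v x) \<bullet> y = x \<bullet> (R *v y)" for x y
    unfolding inner_commute[of "R *v x"] form by (simp add: mult.commute)
  obtain B where B: "finite B" "pairwise orthogonal B" "\<And>b. b \<in> B \<Longrightarrow> norm b = 1" "span B = UNIV"
    and card: "\<And>c. card {b \<in> B. b \<bullet> (R *v b) = c} = dim {v. R *v v = c *\<^sub>R v}"
    by (rule selfadjoint_orthonormal_eigenbasis[OF matrix_vector_mul_linear sym]) (rule that)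
  have cx: "continuous_on {0..T} ?x" by (intro continuous_intros cont)
  \<comment> \<open>Stated for an arbitrary finite family because it is applied both to the
    eigenbasis \<open>B\<close> and to \<open>phi\<close>.\<close>
  have sum: "(\<Sum>i\<in>I. e i \<bullet> (R *v e i)) =
      integral {0..T} (\<lambda>t. \<Sum>i\<in>I. (e i \<bullet> ?x t)\<^sup>2) + \<mu>\<^sup>2 * integral {0..T} (\<lambda>t. \<Sum>i\<in>I. (e i \<bullet> ?g t)\<^sup>2)"
    if "finite I" for I and e :: "'i \<Rightarrow> real^'n"
  proof -
    have "integral {0..T} (\<lambda>t. \<Sum>i\<in>I. (e i \<bullet> y t)\<^sup>2) = (\<Sum>i\<in>I. integral {0..T} (\<lambda>t. (e i \<bullet> y t)\<^sup>2))"
      if "continuous_on {0..T} y" for y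
      using that \<open>finite I\<close>
      by (intro integral_sum integrable_continuous_real continuous_intros)
    note swap = this[OF cx] this[OF cont(2)]
    show ?thesis
      by (simp only: form sum.distrib power2_eq_square[symmetric] sum_distrib_left[symmetric] swap)
  qed
  have "(\<Sum>j=1..d. lam j) = (\<Sum>b\<in>B. b \<bullet> (R *v b))"
  proof (rule sum_eq_if_card_fibres_eq[OF finite_atLeastAtMost B(1)])
    show "card {j \<in> {1..d}. lam j = c} = card {b \<in> B. b \<bullet> (R *v b) = c}" if "c \<noteq> 0" for c
      using lam that unfolding nonzero_eigenvalues_def eigenspace_def card by blast
  qed
  also have "\<dots> = integral {0..T} (\<lambda>t. (norm (?x t))\<^sup>2) + \<mu>\<^sup>2 * integral {0..T} (\<lambda>t. (norm (?g t))\<^sup>2)"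
  proof -
    have "(norm x)\<^sup>2 = (\<Sum>b\<in>B. (b \<bullet> x)\<^sup>2)" for x by (rule parseval[OF B(1,2) _ B(4)]) (rule B(3))
    thus ?thesis by (simp only: sum[OF B(1)])
  qed
  finally have total: "(\<Sum>j=1..d. lam j) = \<dots>" .
  have "(\<Sum>j=1..r. lam j) = (\<Sum>j=1..r. phi j \<bullet> (R *v phi j))"
    using pod by (intro sum.cong) (auto simp: pod_basis_def)
  also have "\<dots> = integral {0..T} (\<lambda>t. \<Sum>j=1..r. (phi j \<bullet> ?x t)\<^sup>2) +
      \<mu>\<^sup>2 * integral {0..T} (\<lambda>t. \<Sum>j=1..r. (phi j \<bullet> ?g t)\<^sup>2)"
    by (rule sum) simp
  finally have captured: "(\<Sum>j=1..r. lam j) = \<dots>" .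
  have split: "integral {0..T} (\<lambda>t. (norm (Q (y t)))\<^sup>2) =
      integral {0..T} (\<lambda>t. (norm (y t))\<^sup>2) - integral {0..T} (\<lambda>t. \<Sum>j=1..r. (phi j \<bullet> y t)\<^sup>2)"
    if "continuous_on {0..T} y" for y
    unfolding Q_def norm_diff_lift_inner[OF on]
    by (intro integral_diff integrable_continuous_real continuous_intros that)
  have "(\<Sum>j=1..d. lam j) = (\<Sum>j=1..r. lam j) + (\<Sum>j=r+1..d. lam j)"
    using \<open>r \<le> d\<close> sum.ub_add_nat[of 1 r lam "d - r"] by simp
  thus ?thesis
    using total captured by (simp add: split[OF cx] split[OF cont(2)] algebra_simps)
qed

section \<open>The error in the reduced coordinates\<close>

text \<open>With the integrating factor \<open>exp (- m * s)\<close>, the function \<open>z\<close>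
  is nonincreasing and starts at 0.\<close>

lemma gronwall_zero_initial:
  fixes y y' f :: "real \<Rightarrow> real"
  assumes f: "continuous_on {0..T} f" "\<And>t. t \<in> {0..T} \<Longrightarrow> 0 \<le> f t"
    and y: "\<And>t. t \<in> {0..T} \<Longrightarrow> (y has_real_derivative y' t) (at t within {0..T})"
    and le: "\<And>t. t \<in> {0..T} \<Longrightarrow> y' t \<le> m * y t + f t"
    and "y 0 = 0" "0 \<le> m" and t: "t \<in> {0..T}"
  shows "y t \<le> exp (m * T) * integral {0..T} f"
proof -
  define z where "z = (\<lambda>s. exp (- m * s) * y s - integral {0..s} f)"
  have z: "(z has_real_derivative exp (- m * s) * (y' s - m * y s) - f s) (at s within {0..T})"
    if "s \<in> {0..T}" for s
  proof -
    have "((\<lambda>s. exp (- m * s)) has_real_derivative - m * exp (- m * s)) (at s within {0..T})"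
      by (auto intro!: derivative_eq_intros)
    from DERIV_diff[OF DERIV_mult[OF this y[OF that]] integral_has_real_derivative[OF f(1) that]]
    show ?thesis unfolding z_def by (rule DERIV_cong) (simp add: algebra_simps)
  qed
  have cz: "continuous_on {0..T} z" using z by (rule DERIV_continuous_on)
  have "z t \<le> z 0"
  proof (rule DERIV_nonpos_imp_decreasing_open[of 0 t z])
    show "0 \<le> t" using t by simp
    show "continuous_on {0..t} z"
      by (rule continuous_on_subset[OF cz]) (use t in auto)
    fix s assume s: "0 < s" "s < t"
    hence "s \<in> {0..T}" and "at s within {0..T} = at s" using t by (auto simp: at_within_Icc_at)
    with z have "DERIV z s :> exp (- m * s) * (y' s - m * y s) - f s" by metis
    moreover have "exp (- m * s) * (y' s - m * y s) \<le> 1 * f s"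
    proof -
      have "exp (- m * s) * (y' s - m * y s) \<le> exp (- m * s) * f s"
        using le[OF \<open>s \<in> {0..T}\<close>] by (intro mult_left_mono) auto
      also have "\<dots> \<le> 1 * f s"
        using f(2)[OF \<open>s \<in> {0..T}\<close>] s \<open>0 \<le> m\<close> by (intro mult_right_mono) auto
      finally show ?thesis .
    qed
    ultimately show "\<exists>y. DERIV z s :> y \<and> y \<le> 0" by force
  qed
  hence "exp (- m * t) * y t \<le> integral {0..t} f"
    using \<open>y 0 = 0\<close> by (simp add: z_def)
  hence "y t \<le> exp (m * t) * integral {0..t} f"
    by (simp add: exp_minus field_simps)
  also have "\<dots> \<le> exp (m * T) * integral {0..T} f"
  proof (intro mult_mono)
    show "exp (m * t) \<le> exp (m * T)" using t \<open>0 \<le> m\<close> by (simp add: mult_left_mono)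
    show "integral {0..t} f \<le> integral {0..T} f"
      using t f by (intro integral_subset_le integrable_continuous_real continuous_on_subset[OF f(1)]) auto
    show "0 \<le> integral {0..t} f"
      using t f by (intro integral_nonneg integrable_continuous_real continuous_on_subset[OF f(1)]) auto
  qed simp
  finally show ?thesis .
qed

text \<open>Finiteness of the extended supremum gives a real constant; the case
  \<open>u = v\<close>, absent from the supremum, is trivial.\<close>

lemma lipschitz_constant_finite:
  assumes "lipschitz_constant F < \<infinity>"
  obtains L where "0 \<le> L" "\<And>u v. norm (F u - F v) \<le> L * norm (u - v)"
proof
  let ?L = "lipschitz_constant F"
  show "0 \<le> enn2real ?L" by simp
  fix u v
  show "norm (F u - F v) \<le> enn2real ?L * norm (u - v)"
  proof (cases "u = v")
    case False
    hence "ennreal (norm (F u - F v) / norm (u - v)) \<le> ?L"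
      unfolding lipschitz_constant_def by (intro SUP_upper2[of "(u, v)"]) auto
    hence "norm (F u - F v) / norm (u - v) \<le> enn2real ?L"
      using assms by (metis ennreal_enn2real ennreal_le_iff enn2real_nonneg infinity_ennreal_def)
    thus ?thesis using False by (simp add: field_simps)
  qed simp
qed

text \<open>Young's inequality for the products of \<open>x\<close> with \<open>z\<close> and with
  \<open>y\<close>. In the energy estimate \<open>x\<close>, \<open>y\<close>, \<open>z\<close> are
  the norms of \<open>\<theta>\<close>, \<open>\<rho>\<close> and \<open>g\<close>.\<close>

lemma rom_defect_estimate:
  fixes x y z K L :: real
  assumes "0 \<le> K" "0 \<le> L"
  shows "2 * x * (K * (z + L * (y + x))) \<le> (K + 3 * K * L) * x\<^sup>2 + (K * z\<^sup>2 + K * L * y\<^sup>2)"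
proof -
  have "0 \<le> K * (x - z)\<^sup>2 + K * L * (x - y)\<^sup>2" using assms by simp
  thus ?thesis by (simp add: power2_eq_square algebra_simps)
qed

text \<open>The constant is explicit in \<open>K\<close>, \<open>L\<close>, \<open>T\<close> and
  \<open>\<mu>\<close>, which makes its independence of the trajectory, of \<open>r\<close> and of
  the basis visible.\<close>

lemma pod_rom_error_bound:
  fixes u :: "real \<Rightarrow> real^'n"
  assumes K: "0 \<le> K" "\<And>x. norm (D *v x) \<le> K * norm x"
    and L: "0 \<le> L" "\<And>x y. norm (gradient H x - gradient H y) \<le> L * norm (x - y)"
    and "T > 0" "\<mu> > 0" and gradH: "continuous_on UNIV (gradient H)"
    and fom: "fom_solution T D H u0 u" and R: "R = snapshot_covariance T \<mu> H u0 u"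
    and lam: "nonzero_eigenvalues R d lam" and "r \<le> d" and pod: "pod_basis R lam r phi"
    and rom: "rom_solution T D H u0 r phi a"
  shows "integral {0..T} (\<lambda>t. (norm (u t - (u0 + lift r phi (a t))))\<^sup>2)
    \<le> (2 + 2 * T * exp ((K + 3 * K * L) * T) * (K / \<mu>\<^sup>2 + K * L)) * (\<Sum>j=r+1..d. lam j)"
proof -
  define P where "P = (\<lambda>x. lift r phi (\<lambda>j. phi j \<bullet> x))"
  define v where "v = (\<lambda>t. u0 + lift r phi (a t))"
  define \<rho> where "\<rho> = (\<lambda>t. u t - u0 - P (u t - u0))"
  define g where "g = (\<lambda>t. gradient H (u t) - P (gradient H (u t)))"
  define \<theta> where "\<theta> = (\<lambda>t. P (u t - u0) - lift r phi (a t))"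
  \<comment> \<open>The derivative of \<open>\<theta>\<close>: project the full equation and
    subtract the lifted reduced one, whose right-hand side is
    \<open>P (D *v P (gradient H (v t)))\<close>.\<close>
  define \<theta>' where "\<theta>' = (\<lambda>t. P (D *v (gradient H (u t) - P (gradient H (v t)))))"
  define f where "f = (\<lambda>t. K * (norm (g t))\<^sup>2 + K * L * (norm (\<rho> t))\<^sup>2)"
  define m where "m = K + 3 * K * L"
  define S where "S = (\<Sum>j=r+1..d. lam j)"
  define c where "c = K / \<mu>\<^sup>2 + K * L"
  have on: "\<forall>i\<in>{1..r}. \<forall>j\<in>{1..r}. phi i \<bullet> phi j = (if i = j then 1 else 0)"
    using pod unfolding pod_basis_def by blast
  have normP: "norm (P x) \<le> norm x" for x unfolding P_def by (rule norm_lift_inner_le[OF on])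
  have P_diff: "P (x - y) = P x - P y" for x y
    by (simp add: P_def lift_def inner_diff_right scaleR_left_diff_distrib sum_subtractf)
  have u': "(u has_vector_derivative D *v gradient H (u t)) (at t within {0..T})"
    if "t \<in> {0..T}" for t using fom that by (simp add: fom_solution_def)
  have cu: "continuous_on {0..T} u"
    using u' has_vector_derivative_continuous by (metis continuous_on_eq_continuous_within)
  have cg: "continuous_on {0..T} (\<lambda>t. gradient H (u t))"
    using continuous_on_compose2[OF gradH cu] by simp
  have a': "((\<lambda>s. a s i) has_real_derivative phi i \<bullet> (D *v P (gradient H (v t)))) (at t within {0..T})"
    if "t \<in> {0..T}" "i \<in> {1..r}" for t i
  proof -
    have "(\<Sum>j=1..r. reduced_matrix D phi i j * reduced_gradient H u0 r phi (a t) j) =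
        phi i \<bullet> (D *v P (gradient H (v t)))"
      by (simp add: reduced_matrix_def reduced_gradient_def P_def v_def lift_def
          linear_sum[OF matrix_vector_mul_linear] inner_sum_right matrix_vector_mult_scaleR mult.commute)
    moreover have "((\<lambda>s. a s i) has_real_derivative
        (\<Sum>j=1..r. reduced_matrix D phi i j * reduced_gradient H u0 r phi (a t) j)) (at t within {0..T})"
      using rom that by (simp add: rom_solution_def)
    ultimately show ?thesis by simp
  qed
  have ca: "continuous_on {0..T} (\<lambda>t. a t i)" if "i \<in> {1..r}" for i
    by (rule DERIV_continuous_on) (rule a'[OF _ that])
  have c\<rho>: "continuous_on {0..T} \<rho>" and c\<theta>: "continuous_on {0..T} \<theta>" and cgp: "continuous_on {0..T} g"
    unfolding \<rho>_def \<theta>_def g_def P_def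
    by (intro continuous_on_diff continuous_on_lift continuous_on_inner continuous_on_const cu cg ca; assumption)+
  have err: "u t - v t = \<rho> t + \<theta> t" for t by (simp add: \<rho>_def \<theta>_def v_def)
  have \<theta>: "(\<theta> has_vector_derivative \<theta>' t) (at t within {0..T})" if t: "t \<in> {0..T}" for t
  proof -
    have "\<theta> = (\<lambda>s. \<Sum>j=1..r. (phi j \<bullet> (u s - u0) - a s j) *\<^sub>R phi j)"
      by (simp add: \<theta>_def P_def lift_def scaleR_left_diff_distrib sum_subtractf)
    moreover have "\<theta>' t =
        (\<Sum>j=1..r. (phi j \<bullet> (D *v gradient H (u t)) - phi j \<bullet> (D *v P (gradient H (v t)))) *\<^sub>R phi j)"
      by (simp add: \<theta>'_def P_def[of] lift_def matrix_vector_mult_diff_distrib inner_diff_right)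
    moreover have "((\<lambda>s. phi j \<bullet> (u s - u0) - a s j) has_vector_derivative
        phi j \<bullet> (D *v gradient H (u t)) - phi j \<bullet> (D *v P (gradient H (v t)))) (at t within {0..T})"
      if "j \<in> {1..r}" for j
    proof (rule has_vector_derivative_diff)
      show "((\<lambda>s. phi j \<bullet> (u s - u0)) has_vector_derivative phi j \<bullet> (D *v gradient H (u t)))
          (at t within {0..T})"
        using u'[OF t]
        by (intro bounded_linear.has_vector_derivative[OF bounded_linear_inner_right])
          (simp add: has_vector_derivative_diff_const)
      show "((\<lambda>s. a s j) has_vector_derivative phi j \<bullet> (D *v P (gradient H (v t)))) (at t within {0..T})"
        using a'[OF t that] by (simp add: has_real_derivative_iff_has_vector_derivative)
    qed
    ultimately show ?thesis
      by (auto intro!: has_vector_derivative_sum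
          bounded_linear.has_vector_derivative[OF bounded_linear_scaleR_left])
  qed
  have \<theta>'_le: "norm (\<theta>' t) \<le> K * (norm (g t) + L * (norm (\<rho> t) + norm (\<theta> t)))" for t
  proof -
    have "gradient H (u t) - P (gradient H (v t)) = g t + P (gradient H (u t) - gradient H (v t))"
      by (simp add: g_def P_diff)
    hence "norm (gradient H (u t) - P (gradient H (v t)))
        \<le> norm (g t) + norm (P (gradient H (u t) - gradient H (v t)))"
      by (simp only: norm_triangle_ineq)
    moreover have "norm (P (gradient H (u t) - gradient H (v t))) \<le> L * norm (u t - v t)"
      by (rule order_trans[OF normP L(2)])
    moreover have "L * norm (u t - v t) \<le> L * (norm (\<rho> t) + norm (\<theta> t))"
      unfolding err using L(1) by (intro mult_left_mono norm_triangle_ineq)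
    ultimately have "norm (gradient H (u t) - P (gradient H (v t)))
        \<le> norm (g t) + L * (norm (\<rho> t) + norm (\<theta> t))"
      by linarith
    hence "K * norm (gradient H (u t) - P (gradient H (v t)))
        \<le> K * (norm (g t) + L * (norm (\<rho> t) + norm (\<theta> t)))"
      using K(1) by (rule mult_left_mono)
    thus ?thesis unfolding \<theta>'_def by (rule order_trans[OF order_trans[OF normP K(2)]])
  qed
  \<comment> \<open>The squared norm is used since the norm itself need not be differentiable where
    \<open>\<theta>\<close> vanishes.\<close>
  have energy: "((\<lambda>s. (norm (\<theta> s))\<^sup>2) has_real_derivative 2 * (\<theta> t \<bullet> \<theta>' t)) (at t within {0..T})"
    if t: "t \<in> {0..T}" for t
  proof -
    have "((\<lambda>s. \<theta> s \<bullet> \<theta> s) has_vector_derivative \<theta> t \<bullet> \<theta>' t + \<theta>' t \<bullet> \<theta> t) (at t within {0..T})"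
      by (intro bounded_bilinear.has_vector_derivative[OF bounded_bilinear_inner] \<theta> t)
    thus ?thesis
      by (simp add: has_real_derivative_iff_has_vector_derivative dot_square_norm inner_commute)
  qed
  have energy_le: "2 * (\<theta> t \<bullet> \<theta>' t) \<le> m * (norm (\<theta> t))\<^sup>2 + f t" for t
  proof -
    have "2 * (\<theta> t \<bullet> \<theta>' t) \<le> 2 * norm (\<theta> t) * norm (\<theta>' t)"
      using norm_cauchy_schwarz[of "\<theta> t" "\<theta>' t"] by simp
    also have "\<dots> \<le> 2 * norm (\<theta> t) * (K * (norm (g t) + L * (norm (\<rho> t) + norm (\<theta> t))))"
      using \<theta>'_le by (intro mult_left_mono) auto
    also have "\<dots> \<le> m * (norm (\<theta> t))\<^sup>2 + f t"
      unfolding m_def f_def using K(1) L(1) by (rule rom_defect_estimate)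
    finally show ?thesis .
  qed
  have tail: "integral {0..T} (\<lambda>t. (norm (\<rho> t))\<^sup>2) + \<mu>\<^sup>2 * integral {0..T} (\<lambda>t. (norm (g t))\<^sup>2) = S"
    unfolding \<rho>_def g_def P_def S_def by (rule pod_projection_error[OF cu cg R lam pod \<open>r \<le> d\<close>])
  have i\<rho>: "(\<lambda>t. (norm (\<rho> t))\<^sup>2) integrable_on {0..T}" and ig: "(\<lambda>t. (norm (g t))\<^sup>2) integrable_on {0..T}"
    by (intro integrable_continuous_real continuous_intros c\<rho> cgp)+
  \<comment> \<open>Both terms of \<open>tail\<close> are nonnegative, so each is bounded by
    \<open>S\<close> separately; division by \<open>\<mu>\<^sup>2\<close> isolates the gradient
    part.\<close>
  have "0 \<le> integral {0..T} (\<lambda>t. (norm (\<rho> t))\<^sup>2)" "0 \<le> integral {0..T} (\<lambda>t. (norm (g t))\<^sup>2)"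
    by (intro integral_nonneg i\<rho> ig; simp)+
  hence \<rho>_le: "integral {0..T} (\<lambda>t. (norm (\<rho> t))\<^sup>2) \<le> S"
    and g_le: "integral {0..T} (\<lambda>t. (norm (g t))\<^sup>2) \<le> S / \<mu>\<^sup>2"
    using tail \<open>\<mu> > 0\<close> by (auto simp: field_simps)
  have "integral {0..T} f = K * integral {0..T} (\<lambda>t. (norm (g t))\<^sup>2) + K * L * integral {0..T} (\<lambda>t. (norm (\<rho> t))\<^sup>2)"
    unfolding f_def using i\<rho> ig by (subst integral_add) (auto intro: integrable_on_mult_right)
  also have "\<dots> \<le> K * (S / \<mu>\<^sup>2) + K * L * S"
    using K(1) L(1) \<rho>_le g_le by (intro add_mono mult_left_mono) auto
  also have "\<dots> = c * S" by (simp add: c_def algebra_simps)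
  finally have f_le: "integral {0..T} f \<le> c * S" .
  have \<theta>_le: "(norm (\<theta> t))\<^sup>2 \<le> exp (m * T) * (c * S)" if t: "t \<in> {0..T}" for t
  proof -
    have "(norm (\<theta> t))\<^sup>2 \<le> exp (m * T) * integral {0..T} f"
    proof (rule gronwall_zero_initial[where y = "\<lambda>s. (norm (\<theta> s))\<^sup>2", OF _ _ energy energy_le _ _ t])
      show "continuous_on {0..T} f" unfolding f_def by (intro continuous_intros c\<rho> cgp)
      show "0 \<le> f s" for s using K(1) L(1) by (simp add: f_def)
      show "0 \<le> m" using K(1) L(1) by (simp add: m_def)
      \<comment> \<open>Shifting by \<open>u0\<close> makes both the projected snapshot and the
        reduced coordinates start at zero.\<close>
      have "u 0 = u0" "\<And>i. i \<in> {1..r} \<Longrightarrow> a 0 i = 0"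
        using fom rom by (auto simp: fom_solution_def rom_solution_def)
      thus "(norm (\<theta> 0))\<^sup>2 = 0" by (simp add: \<theta>_def P_def lift_def)
    qed
    also have "\<dots> \<le> exp (m * T) * (c * S)" using f_le by simp
    finally show ?thesis .
  qed
  \<comment> \<open>The factors 2 come from the square of a sum, and the factor \<open>T\<close>
    from integrating the uniform bound on \<open>\<theta>\<close>.\<close>
  have "integral {0..T} (\<lambda>t. (norm (u t - v t))\<^sup>2)
      \<le> integral {0..T} (\<lambda>t. 2 * (norm (\<rho> t))\<^sup>2 + 2 * (exp (m * T) * (c * S)))"
  proof (rule integral_le)
    show "(\<lambda>t. (norm (u t - v t))\<^sup>2) integrable_on {0..T}"
      unfolding err by (intro integrable_continuous_real continuous_intros c\<rho> c\<theta>)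
    show "(\<lambda>t. 2 * (norm (\<rho> t))\<^sup>2 + 2 * (exp (m * T) * (c * S))) integrable_on {0..T}"
      by (intro integrable_continuous_real continuous_intros c\<rho>)
    fix t assume t: "t \<in> {0..T}"
    have "(norm (u t - v t))\<^sup>2 \<le> (norm (\<rho> t) + norm (\<theta> t))\<^sup>2"
      unfolding err by (intro power_mono norm_triangle_ineq) simp
    also have "\<dots> \<le> 2 * (norm (\<rho> t))\<^sup>2 + 2 * (norm (\<theta> t))\<^sup>2"
      using sum_squares_bound[of "norm (\<rho> t)" "norm (\<theta> t)"] by (simp add: power2_sum)
    finally show "(norm (u t - v t))\<^sup>2 \<le> 2 * (norm (\<rho> t))\<^sup>2 + 2 * (exp (m * T) * (c * S))"
      using \<theta>_le[OF t] by linarith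
  qed
  also have "\<dots> = 2 * integral {0..T} (\<lambda>t. (norm (\<rho> t))\<^sup>2) + T * (2 * (exp (m * T) * (c * S)))"
    using i\<rho> \<open>T > 0\<close> by (subst integral_add) (auto intro: integrable_on_mult_right)
  also have "\<dots> \<le> 2 * S + T * (2 * (exp (m * T) * (c * S)))" using \<rho>_le by simp
  also have "\<dots> = (2 + 2 * T * exp (m * T) * c) * S" by (simp add: algebra_simps)
  finally show ?thesis by (simp add: v_def m_def c_def S_def)
qed

theorem theorem4p2:
  fixes D :: "real^'n^'n" and H :: "real^'n \<Rightarrow> real" and T \<mu> :: real
  assumes "skew_symmetric D"
    and "continuously_differentiable H"
    and "lipschitz_constant (gradient H) < \<infinity>"
    and "T > 0" and "\<mu> > 0"
  shows "\<exists>C::real. \<forall>(u0 :: real^'n) (u :: real \<Rightarrow> real^'n) (R :: real^'n^'n) (d::nat)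
           (lam :: nat \<Rightarrow> real) (r::nat) (phi :: nat \<Rightarrow> real^'n) (a :: real \<Rightarrow> nat \<Rightarrow> real).
           fom_solution T D H u0 u \<longrightarrow>
           R = snapshot_covariance T \<mu> H u0 u \<longrightarrow>
           d = rank R \<longrightarrow>
           nonzero_eigenvalues R d lam \<longrightarrow>
           1 \<le> r \<longrightarrow> r \<le> d \<longrightarrow>
           pod_basis R lam r phi \<longrightarrow>
           rom_solution T D H u0 r phi a \<longrightarrow>
           integral {0..T} (\<lambda>t. (norm (u t - (u0 + lift r phi (a t))))\<^sup>2)
             \<le> C * (\<Sum>j=r+1..d. lam j)"
proof -
  obtain L where L: "0 \<le> L" "\<And>x y. norm (gradient H x - gradient H y) \<le> L * norm (x - y)"
    using lipschitz_constant_finite[OF assms(3)] by blast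
  have K: "0 \<le> onorm ((*v) D)" "norm (D *v x) \<le> onorm ((*v) D) * norm x" for x
    by (auto intro: onorm onorm_pos_le)
  have "continuous_on UNIV (gradient H)"
    using assms(2) by (simp add: continuously_differentiable_def)
  note bound = pod_rom_error_bound[OF K L assms(4,5) this]
  \<comment> \<open>The witness is fixed before the universal variables are introduced; it involves
    only \<open>T\<close>, \<open>\<mu>\<close>, the operator norm of \<open>D\<close> and the
    Lipschitz bound \<open>L\<close> of the gradient.\<close>
  show ?thesis by (intro exI allI impI) (rule bound)
qed

end
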